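(* For all real $x>0$ and $k>0$, $$\beta_k\left(\frac{x+k}{2}\right)=\int_0^\infty\frac{e^{-xt}}{\cosh(kt)}\,dt=\int_0^\infty\frac{2e^{-xt}}{e^{kt}+e^{-kt}}\,dt.$$
   Context: For $k>0$ and $x>0$, the Nielsen $k$-beta function is $\beta_k(x)=\int_0^1\frac{t^{x-1}}{1+t^k}\,dt$. *)

theory Defs
  imports "HOL-Analysis.Analysis"
begin

text \<open>
  The Nielsen \<open>k\<close>-beta function, meaningful for \<open>k > 0\<close> and \<open>x > 0\<close>. The interval integral ranges
  over the open interval from \<open>0\<close> to \<open>1\<close>, so the value of the integrand at \<open>0\<close> plays no role.
\<close>

definition nielsen_beta :: "real \<Rightarrow> real \<Rightarrow> real" where
  "nielsen_beta k x = (LBINT t=0..1. t powr (x - 1) / (1 + t powr k))"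

end

theory Submission
  imports Defs "HOL-Real_Asymp.Real_Asymp"
begin

text \<open>The antiderivative \<open>- exp (- x * t) / x\<close> has finite limits at both ends,
  which yields integrability because the integrand is nonnegative. This exponential is the majorant
  for the \<open>cosh\<close> integrand.\<close>

lemma set_integrable_exp_minus:
  fixes x :: real
  assumes "x > 0"
  shows "set_integrable lborel {0<..} (\<lambda>t. exp (- x * t))"
proof -
  have "set_integrable lborel (einterval 0 \<infinity>) (\<lambda>t. exp (- x * t))"
  proof (rule interval_integral_FTC_nonneg(1))
    show "DERIV (\<lambda>t. - exp (- x * t) / x) t :> exp (- x * t)" for t
      using assms by (auto intro!: derivative_eq_intros)
    show "(((\<lambda>t. - exp (- x * t) / x) \<circ> real_of_ereal) \<longlongrightarrow> - exp (- x * 0) / x) (at_right 0)"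
      unfolding zero_ereal_def ereal_tendsto_simps
      using assms by (intro tendsto_intros) auto
    have "((\<lambda>t. - exp (- x * t) / x) \<longlongrightarrow> 0) at_top"
      using assms by real_asymp
    then show "(((\<lambda>t. - exp (- x * t) / x) \<circ> real_of_ereal) \<longlongrightarrow> 0) (at_left \<infinity>)"
      by (simp add: ereal_tendsto_simps)
  qed auto
  then show ?thesis
    by (simp add: zero_ereal_def)
qed

text \<open>Domination by \<open>exp (- x * t)\<close>, since \<open>cosh\<close> is at least 1
  everywhere.\<close>

lemma set_integrable_exp_div_cosh:
  fixes x k :: real
  assumes "x > 0"
  shows "set_integrable lborel {0<..} (\<lambda>t. exp (- x * t) / cosh (k * t))"
proof (rule set_integrable_bound[OF set_integrable_exp_minus[OF assms]])
  have "continuous_on UNIV (\<lambda>t. exp (- x * t) / cosh (k * t))"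
    by (intro continuous_intros) simp_all
  then have "(\<lambda>t. exp (- x * t) / cosh (k * t)) \<in> borel_measurable lborel"
    using borel_measurable_continuous_onI by simp
  then show "set_borel_measurable lborel {0<..} (\<lambda>t. exp (- x * t) / cosh (k * t))"
    unfolding set_borel_measurable_def by measurable
  have "1 \<le> cosh (k * t)" for t
    by (rule cosh_real_ge_1)
  then have "exp (- x * t) / cosh (k * t) \<le> exp (- x * t)" for t
    by (metis div_by_1 exp_ge_zero frac_le order_refl zero_less_one)
  then show "AE t in lborel. t \<in> {0<..} \<longrightarrow>
      norm (exp (- x * t) / cosh (k * t)) \<le> norm (exp (- x * t))"
    by simp
qed

lemma exp_div_cosh_conv:
  fixes x k t :: real
  shows "exp (- x * t) / cosh (k * t) = 2 * exp (- x * t) / (exp (k * t) + exp (- k * t))"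
  by (simp add: cosh_field_def)

text \<open>
  The substitution is \<open>t = exp (2 * u)\<close> with \<open>u < 0\<close>, followed by \<open>u = - s\<close>, rather than
  \<open>t = exp (- 2 * s)\<close> at once: the substitution rule for integrals requires an increasing map.
\<close>

lemma nielsen_integrand_subst:
  fixes x k u :: real
  shows "exp (2 * u) powr ((x + k) / 2 - 1) / (1 + exp (2 * u) powr k) * (2 * exp (2 * u)) =
    exp (x * u) / cosh (k * u)"
proof -
  \<comment> \<open>The Jacobian factor \<open>exp (2 * u)\<close> cancels the \<open>- 1\<close> in
    the exponent, leaving \<open>(x + k) * u\<close>.\<close>
  have num: "exp (((x + k) / 2 - 1) * (2 * u)) * exp (2 * u) = exp (x * u) * exp (k * u)"
    by (simp flip: exp_add) (simp add: field_simps)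
  \<comment> \<open>The factor \<open>exp (k * u)\<close> pulled out here cancels against the one in
    \<open>num\<close>; what remains is \<open>2 * cosh (k * u)\<close>.\<close>
  have den: "1 + exp (k * (2 * u)) = exp (k * u) * (exp (k * u) + exp (- (k * u)))"
    by (simp add: distrib_left flip: exp_add)
  have "exp (2 * u) powr ((x + k) / 2 - 1) / (1 + exp (2 * u) powr k) * (2 * exp (2 * u)) =
    2 * (exp (((x + k) / 2 - 1) * (2 * u)) * exp (2 * u)) / (1 + exp (k * (2 * u)))"
    by (simp add: powr_def mult_ac)
  also have "\<dots> = exp (x * u) / cosh (k * u)"
    unfolding num den by (simp add: cosh_field_def)
  finally show ?thesis .
qed

theorem theorem5p3:
  fixes x k :: real
  assumes "x > 0" and "k > 0"
  shows "interval_lebesgue_integrable lborel 0 1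
           (\<lambda>t. t powr ((x + k) / 2 - 1) / (1 + t powr k)) \<and>
         interval_lebesgue_integrable lborel 0 \<infinity> (\<lambda>t. exp (- x * t) / cosh (k * t)) \<and>
         interval_lebesgue_integrable lborel 0 \<infinity>
           (\<lambda>t. 2 * exp (- x * t) / (exp (k * t) + exp (- k * t))) \<and>
         nielsen_beta k ((x + k) / 2) = (LBINT t=0..\<infinity>. exp (- x * t) / cosh (k * t)) \<and>
         (LBINT t=0..\<infinity>. exp (- x * t) / cosh (k * t)) =
           (LBINT t=0..\<infinity>. 2 * exp (- x * t) / (exp (k * t) + exp (- k * t)))"
proof -
  let ?c = "\<lambda>t. exp (- x * t) / cosh (k * t)"
  let ?f = "\<lambda>t. t powr ((x + k) / 2 - 1) / (1 + t powr k)"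
  let ?h = "\<lambda>u. ?f (exp (2 * u)) * (2 * exp (2 * u))"
  have c: "interval_lebesgue_integrable lborel 0 \<infinity> ?c"
    using set_integrable_exp_div_cosh[OF assms(1)]
    by (simp add: interval_lebesgue_integral_0_infty)
  \<comment> \<open>Evenness of \<open>cosh\<close> absorbs the sign change in the
    denominator.\<close>
  have h: "?h = (\<lambda>u. ?c (- u))"
    by (rule ext) (simp only: nielsen_integrand_subst, simp)
  have "interval_lebesgue_integrable lborel (-\<infinity>) 0 (\<lambda>u. ?c (- u))"
    using c interval_integrable_mirror[of "-\<infinity>" 0 ?c] by simp
  \<comment> \<open>Integrability passes from the transformed integrand back to \<open>?f\<close>,
    so the possible singularity of \<open>?f\<close> at 0 (when \<open>x + k < 2\<close>) needs no
    separate estimate.\<close>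
  then have int_h: "set_integrable lborel (einterval (-\<infinity>) 0) ?h"
    unfolding h by (simp add: interval_lebesgue_integrable_def)
  have lim0: "((ereal \<circ> (\<lambda>u. exp (2 * u)) \<circ> real_of_ereal) \<longlongrightarrow> 0) (at_right (-\<infinity>))"
  proof -
    have "((\<lambda>u::real. exp (2 * u)) \<longlongrightarrow> 0) at_bot"
      by real_asymp
    then show ?thesis
      by (simp add: ereal_tendsto_simps zero_ereal_def)
  qed
  have lim1: "((ereal \<circ> (\<lambda>u. exp (2 * u)) \<circ> real_of_ereal) \<longlongrightarrow> 1) (at_left 0)"
  proof -
    have "((\<lambda>u::real. exp (2 * u)) \<longlongrightarrow> 1) (at_left 0)"
      by real_asymp
    then show ?thesis
      by (simp add: ereal_tendsto_simps zero_ereal_def one_ereal_def)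
  qed
  \<comment> \<open>The two limits fix the image interval as 0 to 1. The six open premises are the
    order of the endpoints, the derivative, two continuity conditions and two sign
    conditions.\<close>
  note subst = interval_integral_substitution_nonneg
    [where f = ?f and g = "\<lambda>u. exp (2 * u)" and g' = "\<lambda>u. 2 * exp (2 * u)",
      OF _ _ _ _ _ _ lim0 lim1 int_h]
  have "set_integrable lborel (einterval 0 1) ?f"
    by (rule subst(1)) (auto intro!: derivative_eq_intros continuous_intros
        simp: add_nonneg_eq_0_iff add_pos_nonneg intro: less_imp_neq[THEN not_sym])
  moreover have "(LBINT t=0..1. ?f t) = (LBINT u=-\<infinity>..0. ?h u)"
    by (rule subst(2)) (auto intro!: derivative_eq_intros continuous_intros
        simp: add_nonneg_eq_0_iff add_pos_nonneg intro: less_imp_neq[THEN not_sym])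
  \<comment> \<open>This is the reflection \<open>u = - t\<close>.\<close>
  moreover have "(LBINT u=-\<infinity>..0. ?h u) = (LBINT t=0..\<infinity>. ?c t)"
    unfolding h by (subst interval_integral_reflect) simp
  ultimately show ?thesis
    using c
    \<comment> \<open>Folding the exponential form back into \<open>?c\<close> makes the last
      equation trivial and reduces its integrability to \<open>c\<close>.\<close>
    by (simp only: nielsen_beta_def flip: exp_div_cosh_conv)
      (simp add: interval_lebesgue_integrable_def)
qed

end
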